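(* Let $\mathcal{C}$ be a closed family. Consider an execution, i.e. a sequence of calls to ASSUME, VALUE and OBSERVE starting from the empty symbolic state, and let $\mathcal{V}$ be its set of random variables. Let $\hat X_e\subseteq\mathcal{V}$ be the set of random variables the developer wants to keep exact, and $\hat X_s=\mathcal{V}\setminus\hat X_e$ the variables the developer wants to sample. Suppose that: - for all calls $(X,g')=\mathrm{ASSUME}(\mu,g)$ such that $X\in\hat X_e$: if $g\in\mathcal{C}$ then $g'\in\mathcal{C}$; - for all calls $(X,g')=\mathrm{ASSUME}(\mu,g)$ such that $X\in\hat X_s$: $X$ is immediately passed to VALUE, and $\mu$ does not depend on any variables in $\hat X_e$. Then all variables in $\hat X_s$ will be sampled by VALUE, and no variable in $\hat X_e$ will ever be passed to VALUE.
   Context: **Expressions and states.** Fix a set of random variable names. Symbolic expressions are $E ::= \mathtt{app}(op,E,\dots,E)\mid r\mid c\mid X$ ($r\in\mathbb{R}$, $c\in\mathbb{Z}$, $X$ a random variable, $op$ one of $+,-,*,/,\mathtt{sqrt},\mathtt{ite},=,\neq,<,\le$, where $\mathtt{ite}$ is if-then-else). Symbolic distributions are $\mathcal{N}(E,E)$ (mean, variance), $\mathrm{Bernoulli}(E)$, $\beta(E,E)$, $\delta(E)$. A symbolic state $g$ is a finite map from random variables to symbolic distributions; $Y$ is a parent of $X$ in $g$ if $Y$ occurs in $g(X)$; a root is a variable with no parents. The parent relation of a valid state is acyclic. Below, $e_1+e_2$, $\frac{e_1}{e_2}$, $\mathtt{ite}(\cdot,\cdot,\cdot)$ etc. denote symbolic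 terms, $e_1[X\leftarrow e_2]$ denotes substitution, and $g[X\mapsto d]$ is $g$ with $X$ remapped to $d$. **Swap.** $\mathrm{SWAP}(X_1,X_2,g)$, applied to a parent $X_1$ and a child $X_2$, returns (state, Boolean): 1. If $g(X_1)=\mathcal{N}(\mu_0,v_0)$, $g(X_2)=\mathcal{N}(\mu,v)$, $\mu$ can be analysed as $a*X_1+b$ with $a,b$ symbolic expressions that may contain random variables other than $X_1$, and $v_0,v$ do not depend on any random variables: with $\mu_0'=(a*\mu_0)+b$, $v_0'=(a*a)*v_0$, $v_0''=\frac{1}{\frac1{v_0'}+\frac1v}$, $\mu_0''=\left(\frac{\mu_0'}{v_0'}+\frac{X_2}{v}\right)*v_0''$, return $\left(g\left[X_1\mapsto\mathcal{N}\left(\frac{\mu_0''-b}{a},\frac{v_0''}{a*a}\right)\right][X_2\mapsto\mathcal{N}(\mu_0',v_0'+v)],\mathbf{true}\right)$. 2. If $g(X_1)=\beta(a,b)$, $g(X_2)=\mathrm{Bernoulli}(X_1)$: return $\left(g[X_1\mapsto\beta(a+\mathtt{ite}(X_2,1,0),b+\mathtt{ite}(X_2,0,1))]\left[X_2\mapsto\mathrm{Bernoulli}\left(\frac{a}{a+b}\right)\right],\mathbf{true}\right)$. 3. If $g(X_1)=\mathrm{Bernoulli}(p_1)$, $g(X_2)=\mathrm{Bernoulli}(p_2)$: with $p_2'=(p_1*p_2[X_1\leftarrow1])+((1-p_1)*p_2[X_1\leftarrow0])$ and $p_1'=\frac{p_1*(\mathtt{ite}(X_2,p_2,1-p_2)[X_1\leftarrow1])}{\mathtt{ite}(X_2,p_2',1-p_2')}$,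 return $(g[X_1\mapsto\mathrm{Bernoulli}(p_1')][X_2\mapsto\mathrm{Bernoulli}(p_2')],\mathbf{true})$. 4. Otherwise return $(g,\mathbf{false})$. A swap makes $X_2$ a parent of $X_1$ instead of the converse and, in general, makes each of $X_1,X_2$ depend on all other parents of either. $\mathrm{CAN\_SWAP}(X_1,X_2,g)$ is true iff swapping $X_1$ and $X_2$ in $g$ does not create a dependency cycle between random variables (the swap is then called legal). **Closed family.** A closed family is a set $\mathcal{C}$ of symbolic states such that if $g\in\mathcal{C}$ and $X_1,X_2$ are variables in $g$ (with $X_1$ a parent of $X_2$) such that $\mathrm{CAN\_SWAP}(X_1,X_2,g)$ holds, then $\mathrm{SWAP}(X_1,X_2,g)=(g',\mathbf{true})$ and $g'\in\mathcal{C}$. **Operations.** $\mathrm{EVAL}(e,g)$ partially evaluates $e$: constants evaluate to themselves; a random variable $X$ evaluates to $\mathrm{EVAL}(e',g)$ if $g(X)=\delta(e')$ and to $X$ otherwise; $\mathtt{app}(op,\dots)$ evaluates its arguments and, if all are constants, computes the result, otherwise leaves the application symbolic. $\mathrm{EVAL}^*(X,g)$ replaces each parameter of $g(X)$ by its partial evaluation. $\mathrm{INTERVENE}(X,v,g)=g[X\mapsto\delta(v)]$. $\mathrm{HOIST\_HELPER}(X_{cur},roots,g)$: (i) let $P$ be the list of parents of $X_{cur}$ in $g$, topologically sorted (ancestors first); $roots':=roots$, $g':=g$. (ii) For $X_{par}\in P$ in order, if $X_{par}\notin roots$: $g':=\mathrm{HOIST\_HELPER}(X_{par},roots',g')$,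 then add $X_{par}$ to $roots'$. (iii) $g'':=g'$; for $X_{par}\in P$ in reverse order, if $X_{par}\notin roots$: assert $\mathrm{CAN\_SWAP}(X_{par},X_{cur},g'')$; $(g'',ok):=\mathrm{SWAP}(X_{par},X_{cur},g'')$; if not $ok$, throw the exception $(X_{par},X_{cur})$. (iv) Return $g''$. $\mathrm{HOIST}(X,g)$: run $\mathrm{HOIST\_HELPER}(X,\emptyset,g)$ and return its result; if an exception $(X_{par},X_{child})$ is thrown, call $\mathrm{VALUE}(X_{par},g)$, obtaining state $g'$, and return $\mathrm{HOIST}(X,\mathrm{EVAL}^*(X_{child},g'))$. $\mathrm{ASSUME}(d,g)=(X_{new},g[X_{new}\mapsto d])$ with $X_{new}$ not assigned in $g$. $\mathrm{VALUE}(X,g)$: $g'=\mathrm{HOIST}(X,g)$; $g''=\mathrm{EVAL}^*(X,g')$; draw a sample $v$ from $g''(X)$; return $v$ and $\mathrm{INTERVENE}(X,v,g'')$. $\mathrm{OBSERVE}(X,v,g)$: $g'=\mathrm{HOIST}(X,g)$; $g''=\mathrm{EVAL}^*(X,g')$; let $s$ be the probability density of $g''(X)$ at $v$; return $\mathrm{INTERVENE}(X,v,g'')$ and $s$.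
   Formalization: Added: C contains the empty state and is stable under INTERVENE on parentless variables; VALUE is called explicitly only on X_s; variables bound to δ(constant) are not parents; the analysis a*X1+b keeps exactly the other variables of μ; ASSUME mentions only assigned variables. *)

theory Defs
  imports "HOL-Probability.Probability"
begin

section \<open>Expressions, distributions, states\<close>

datatype val = RealV real | IntV int

fun real_of_val :: "val \<Rightarrow> real" where
  "real_of_val (RealV r) = r"
| "real_of_val (IntV i) = of_int i"

datatype oper = Add | Sub | Mul | Div | Sqrt | Ite | Eq | Neq | Less | Leq

datatype 'x expr = App oper "'x expr list" | Const val | Var 'x

datatype 'x dist =
    Gaussian "'x expr" "'x expr"  \<comment> \<open>mean, variance\<close>
  | Bern "'x expr"
  | BetaD "'x expr" "'x expr"
  | Dirac "'x expr"

type_synonym 'x state = "'x \<rightharpoonup> 'x dist"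

abbreviation eadd (infixl "+\<^sub>e" 65) where "e1 +\<^sub>e e2 \<equiv> App Add [e1, e2]"
abbreviation esub (infixl "-\<^sub>e" 65) where "e1 -\<^sub>e e2 \<equiv> App Sub [e1, e2]"
abbreviation emul (infixl "*\<^sub>e" 70) where "e1 *\<^sub>e e2 \<equiv> App Mul [e1, e2]"
abbreviation ediv (infixl "'/\<^sub>e" 70) where "e1 /\<^sub>e e2 \<equiv> App Div [e1, e2]"
abbreviation eite where "eite e1 e2 e3 \<equiv> App Ite [e1, e2, e3]"
abbreviation eint :: "int \<Rightarrow> 'x expr" where "eint i \<equiv> Const (IntV i)"

fun fv :: "'x expr \<Rightarrow> 'x set" where
  "fv (App op es) = (\<Union>e\<in>set es. fv e)"
| "fv (Const c) = {}"
| "fv (Var X) = {X}"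

fun fvd :: "'x dist \<Rightarrow> 'x set" where
  "fvd (Gaussian m v) = fv m \<union> fv v"
| "fvd (Bern p) = fv p"
| "fvd (BetaD a b) = fv a \<union> fv b"
| "fvd (Dirac e) = fv e"

fun subst :: "'x \<Rightarrow> 'x expr \<Rightarrow> 'x expr \<Rightarrow> 'x expr" where
  "subst X s (App op es) = App op (map (subst X s) es)"
| "subst X s (Const c) = Const c"
| "subst X s (Var Y) = (if Y = X then s else Var Y)"

text \<open>
  A variable bound to a Dirac distribution at a constant, which is what intervening on it
  produces, has a value and is no longer random.  References to it are references to that
  value, so they do not count as dependencies.  (If they did, then no state in which a sampled
  or observed variable still occurs in another distribution could belong to a closed family,
  because swapping with a Dirac variable always fails.)
\<close>

definition valued :: "'x state \<Rightarrow> 'x \<Rightarrow> bool" where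
  "valued g X \<longleftrightarrow> (\<exists>c. g X = Some (Dirac (Const c)))"

definition deps :: "'x state \<Rightarrow> 'x expr \<Rightarrow> 'x set" where
  "deps g e = {Y \<in> fv e. \<not> valued g Y}"

definition parents :: "'x state \<Rightarrow> 'x \<Rightarrow> 'x set" where
  "parents g X = (case g X of None \<Rightarrow> {} | Some d \<Rightarrow> {Y \<in> fvd d. \<not> valued g Y})"

definition parent_rel :: "'x state \<Rightarrow> ('x \<times> 'x) set" where
  "parent_rel g = {(Y, X). Y \<in> parents g X}"


section \<open>Partial evaluation\<close>

fun arith :: "(int \<Rightarrow> int \<Rightarrow> int) \<Rightarrow> (real \<Rightarrow> real \<Rightarrow> real) \<Rightarrow> val \<Rightarrow> val \<Rightarrow> val" where
  "arith f h (IntV i) (IntV j) = IntV (f i j)"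
| "arith f h x y = RealV (h (real_of_val x) (real_of_val y))"

text \<open>Truth values are the integers 1 and 0.  The result is \<open>None\<close> where the operation is undefined.\<close>

fun compute :: "oper \<Rightarrow> val list \<Rightarrow> val option" where
  "compute Add [x, y] = Some (arith (+) (+) x y)"
| "compute Sub [x, y] = Some (arith (-) (-) x y)"
| "compute Mul [x, y] = Some (arith (*) (*) x y)"
| "compute Div [x, y] =
     (if real_of_val y = 0 then None else Some (RealV (real_of_val x / real_of_val y)))"
| "compute Sqrt [x] = (if real_of_val x < 0 then None else Some (RealV (sqrt (real_of_val x))))"
| "compute Ite [c, x, y] = Some (if real_of_val c \<noteq> 0 then x else y)"
| "compute Eq [x, y] = Some (IntV (of_bool (real_of_val x = real_of_val y)))"
| "compute Neq [x, y] = Some (IntV (of_bool (real_of_val x \<noteq> real_of_val y)))"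
| "compute Less [x, y] = Some (IntV (of_bool (real_of_val x < real_of_val y)))"
| "compute Leq [x, y] = Some (IntV (of_bool (real_of_val x \<le> real_of_val y)))"
| "compute _ _ = None"

definition apply_oper :: "oper \<Rightarrow> 'x expr list \<Rightarrow> 'x expr" where
  "apply_oper op es =
     (if \<exists>vs v. es = map Const vs \<and> compute op vs = Some v
      then Const (THE v. \<exists>vs. es = map Const vs \<and> compute op vs = Some v)
      else App op es)"

text \<open>A relation, because the recursion through Dirac variables ends only on acyclic states.\<close>

inductive eval :: "'x state \<Rightarrow> 'x expr \<Rightarrow> 'x expr \<Rightarrow> bool" for g where
  "eval g (Const c) (Const c)"
| "g X = Some (Dirac e) \<Longrightarrow> eval g e r \<Longrightarrow> eval g (Var X) r"
| "\<nexists>e. g X = Some (Dirac e) \<Longrightarrow> eval g (Var X) (Var X)"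
| "list_all2 (eval g) es es' \<Longrightarrow> eval g (App op es) (apply_oper op es')"

inductive eval_dist :: "'x state \<Rightarrow> 'x dist \<Rightarrow> 'x dist \<Rightarrow> bool" for g where
  "eval g m m' \<Longrightarrow> eval g v v' \<Longrightarrow> eval_dist g (Gaussian m v) (Gaussian m' v')"
| "eval g p p' \<Longrightarrow> eval_dist g (Bern p) (Bern p')"
| "eval g a a' \<Longrightarrow> eval g b b' \<Longrightarrow> eval_dist g (BetaD a b) (BetaD a' b')"
| "eval g e e' \<Longrightarrow> eval_dist g (Dirac e) (Dirac e')"

definition eval_star :: "'x \<Rightarrow> 'x state \<Rightarrow> 'x state \<Rightarrow> bool" where
  "eval_star X g g' \<longleftrightarrow> (\<exists>d d'. g X = Some d \<and> eval_dist g d d' \<and> g' = g(X \<mapsto> d'))"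


section \<open>Swap\<close>

text \<open>
  \<open>aff X e = Some (a, b)\<close> says that the analysis recognises \<open>e\<close> as \<open>a * X + b\<close>.  The choice of
  analysis is left open.  It must be sound, and \<open>a\<close> and \<open>b\<close> together mention exactly
  the variables of \<open>e\<close> other than \<open>X\<close>, so that after a swap both variables depend on the other
  parents of either.  The equation is required where both sides are defined.
\<close>

type_synonym 'x analysis = "'x \<Rightarrow> 'x expr \<Rightarrow> ('x expr \<times> 'x expr) option"

definition affine_analysis :: "'x analysis \<Rightarrow> bool" where
  "affine_analysis aff \<longleftrightarrow>
     (\<forall>X e a b. aff X e = Some (a, b) \<longrightarrow>
        fv a \<union> fv b = fv e - {X} \<and>
        (\<forall>\<sigma> u w. eval (\<lambda>Y. Some (Dirac (Const (\<sigma> Y)))) e (Const u) \<longrightarrow>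
                 eval (\<lambda>Y. Some (Dirac (Const (\<sigma> Y)))) ((a *\<^sub>e Var X) +\<^sub>e b) (Const w) \<longrightarrow>
                 real_of_val u = real_of_val w))"

definition swap_gaussian ::
  "'x \<Rightarrow> 'x \<Rightarrow> 'x expr \<Rightarrow> 'x expr \<Rightarrow> 'x expr \<Rightarrow> 'x expr \<Rightarrow> 'x expr \<Rightarrow> 'x state \<Rightarrow> 'x state"
where
  "swap_gaussian X1 X2 \<mu>0 v0 a b v g =
     (let \<mu>0' = (a *\<^sub>e \<mu>0) +\<^sub>e b;
          v0' = (a *\<^sub>e a) *\<^sub>e v0;
          v0'' = eint 1 /\<^sub>e ((eint 1 /\<^sub>e v0') +\<^sub>e (eint 1 /\<^sub>e v));
          \<mu>0'' = ((\<mu>0' /\<^sub>e v0') +\<^sub>e (Var X2 /\<^sub>e v)) *\<^sub>e v0''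
      in g(X1 \<mapsto> Gaussian ((\<mu>0'' -\<^sub>e b) /\<^sub>e a) (v0'' /\<^sub>e (a *\<^sub>e a)),
           X2 \<mapsto> Gaussian \<mu>0' (v0' +\<^sub>e v)))"

definition swap_beta_bern :: "'x \<Rightarrow> 'x \<Rightarrow> 'x expr \<Rightarrow> 'x expr \<Rightarrow> 'x state \<Rightarrow> 'x state" where
  "swap_beta_bern X1 X2 a b g =
     g(X1 \<mapsto> BetaD (a +\<^sub>e eite (Var X2) (eint 1) (eint 0)) (b +\<^sub>e eite (Var X2) (eint 0) (eint 1)),
       X2 \<mapsto> Bern (a /\<^sub>e (a +\<^sub>e b)))"

definition swap_bern :: "'x \<Rightarrow> 'x \<Rightarrow> 'x expr \<Rightarrow> 'x expr \<Rightarrow> 'x state \<Rightarrow> 'x state" where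
  "swap_bern X1 X2 p1 p2 g =
     (let p2' = (p1 *\<^sub>e subst X1 (eint 1) p2) +\<^sub>e ((eint 1 -\<^sub>e p1) *\<^sub>e subst X1 (eint 0) p2);
          p1' = (p1 *\<^sub>e subst X1 (eint 1) (eite (Var X2) p2 (eint 1 -\<^sub>e p2)))
                /\<^sub>e eite (Var X2) p2' (eint 1 -\<^sub>e p2')
      in g(X1 \<mapsto> Bern p1', X2 \<mapsto> Bern p2'))"

definition swap :: "'x analysis \<Rightarrow> 'x \<Rightarrow> 'x \<Rightarrow> 'x state \<Rightarrow> 'x state \<times> bool" where
  "swap aff X1 X2 g =
     (case (g X1, g X2) of
        (Some (Gaussian \<mu>0 v0), Some (Gaussian \<mu> v)) \<Rightarrow>
          (case aff X1 \<mu> of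
             Some (a, b) \<Rightarrow>
               if deps g v0 = {} \<and> deps g v = {}
               then (swap_gaussian X1 X2 \<mu>0 v0 a b v g, True) else (g, False)
           | None \<Rightarrow> (g, False))
      | (Some (BetaD a b), Some (Bern p)) \<Rightarrow>
          if p = Var X1 then (swap_beta_bern X1 X2 a b g, True) else (g, False)
      | (Some (Bern p1), Some (Bern p2)) \<Rightarrow> (swap_bern X1 X2 p1 p2 g, True)
      | _ \<Rightarrow> (g, False))"

definition swapped_parents :: "'x \<Rightarrow> 'x \<Rightarrow> 'x state \<Rightarrow> 'x \<Rightarrow> 'x set" where
  "swapped_parents X1 X2 g Z =
     (let others = (parents g X1 \<union> parents g X2) - {X1, X2}
      in if Z = X1 then insert X2 others else if Z = X2 then others else parents g Z)"

definition can_swap :: "'x \<Rightarrow> 'x \<Rightarrow> 'x state \<Rightarrow> bool" where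
  "can_swap X1 X2 g \<longleftrightarrow> acyclic {(Y, Z). Y \<in> swapped_parents X1 X2 g Z}"

definition closed_family :: "'x analysis \<Rightarrow> 'x state set \<Rightarrow> bool" where
  "closed_family aff C \<longleftrightarrow>
     (\<forall>g\<in>C. finite (dom g)) \<and>
     (\<forall>g\<in>C. \<forall>X1\<in>dom g. \<forall>X2\<in>dom g.
        X1 \<in> parents g X2 \<and> can_swap X1 X2 g \<longrightarrow>
        (\<exists>g'. swap aff X1 X2 g = (g', True) \<and> g' \<in> C))"


section \<open>Hoisting\<close>

datatype 'x outcome = Return "'x state" | Throw 'x 'x | Assertion_failed

definition topo_sorted :: "'x state \<Rightarrow> 'x list \<Rightarrow> bool" where
  "topo_sorted g P \<longleftrightarrow> distinct P \<and>
     (\<forall>i j. i < j \<longrightarrow> j < length P \<longrightarrow> (P ! j, P ! i) \<notin> (parent_rel g)\<^sup>+)"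

fun swap_parents :: "'x analysis \<Rightarrow> 'x \<Rightarrow> 'x set \<Rightarrow> 'x list \<Rightarrow> 'x state \<Rightarrow> 'x outcome" where
  "swap_parents aff Xcur roots [] g = Return g"
| "swap_parents aff Xcur roots (Xpar # Xs) g =
     (if Xpar \<in> roots then swap_parents aff Xcur roots Xs g
      else if \<not> can_swap Xpar Xcur g then Assertion_failed
      else case swap aff Xpar Xcur g of
             (g', ok) \<Rightarrow> if ok then swap_parents aff Xcur roots Xs g' else Throw Xpar Xcur)"

text \<open>
  \<open>hoist_parents aff roots P roots' g r\<close> is the loop that hoists the parents, started with
  \<open>roots' = roots\<close>.  Any topological sort of the parents may be used.
\<close>

inductive
  hoist_helper :: "'x analysis \<Rightarrow> 'x \<Rightarrow> 'x set \<Rightarrow> 'x state \<Rightarrow> 'x outcome \<Rightarrow> bool" and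
  hoist_parents :: "'x analysis \<Rightarrow> 'x set \<Rightarrow> 'x list \<Rightarrow> 'x set \<Rightarrow> 'x state \<Rightarrow> 'x outcome \<Rightarrow> bool"
  for aff
where
  "\<lbrakk>set P = parents g Xcur; topo_sorted g P; hoist_parents aff roots P roots g (Return g')\<rbrakk>
   \<Longrightarrow> hoist_helper aff Xcur roots g (swap_parents aff Xcur roots (rev P) g')"
| "\<lbrakk>set P = parents g Xcur; topo_sorted g P; hoist_parents aff roots P roots g r;
    \<nexists>g'. r = Return g'\<rbrakk>
   \<Longrightarrow> hoist_helper aff Xcur roots g r"
| "hoist_parents aff roots [] roots' g (Return g)"
| "\<lbrakk>Xpar \<in> roots; hoist_parents aff roots P roots' g r\<rbrakk>
   \<Longrightarrow> hoist_parents aff roots (Xpar # P) roots' g r"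
| "\<lbrakk>Xpar \<notin> roots; hoist_helper aff Xpar roots' g (Return g');
    hoist_parents aff roots P (insert Xpar roots') g' r\<rbrakk>
   \<Longrightarrow> hoist_parents aff roots (Xpar # P) roots' g r"
| "\<lbrakk>Xpar \<notin> roots; hoist_helper aff Xpar roots' g r; \<nexists>g'. r = Return g'\<rbrakk>
   \<Longrightarrow> hoist_parents aff roots (Xpar # P) roots' g r"


section \<open>The operations\<close>

definition intervene :: "'x \<Rightarrow> val \<Rightarrow> 'x state \<Rightarrow> 'x state" where
  "intervene X v g = g(X \<mapsto> Dirac (Const v))"

text \<open>Densities are with respect to Lebesgue measure or, for discrete distributions, counting
  measure; they are undefined when a parameter is not a constant or is out of range.\<close>

fun dist_density :: "'x dist \<Rightarrow> val \<Rightarrow> real option" where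
  "dist_density (Gaussian (Const m) (Const s)) v =
     (if real_of_val s > 0
      then Some (normal_density (real_of_val m) (sqrt (real_of_val s)) (real_of_val v)) else None)"
| "dist_density (Bern (Const p)) v =
     (if 0 \<le> real_of_val p \<and> real_of_val p \<le> 1
      then Some (if real_of_val v = 1 then real_of_val p
                 else if real_of_val v = 0 then 1 - real_of_val p else 0) else None)"
| "dist_density (BetaD (Const a) (Const b)) v =
     (if real_of_val a > 0 \<and> real_of_val b > 0
      then Some (if 0 < real_of_val v \<and> real_of_val v < 1
                 then real_of_val v powr (real_of_val a - 1) *
                      (1 - real_of_val v) powr (real_of_val b - 1) /
                      Beta (real_of_val a) (real_of_val b)
                 else 0) else None)"
| "dist_density (Dirac (Const c)) v = Some (of_bool (real_of_val v = real_of_val c))"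
| "dist_density _ v = None"

text \<open>Drawing is nondeterministic: any value of positive density may be drawn.\<close>

definition may_draw :: "'x dist \<Rightarrow> val \<Rightarrow> bool" where
  "may_draw d v \<longleftrightarrow> (\<exists>s. dist_density d v = Some s \<and> s > 0)"

inductive
  hoist_returns :: "'x analysis \<Rightarrow> 'x \<Rightarrow> 'x state \<Rightarrow> 'x state \<Rightarrow> bool" and
  value_returns :: "'x analysis \<Rightarrow> 'x \<Rightarrow> 'x state \<Rightarrow> val \<Rightarrow> 'x state \<Rightarrow> bool"
  for aff
where
  "hoist_helper aff X {} g (Return g') \<Longrightarrow> hoist_returns aff X g g'"
| "\<lbrakk>hoist_helper aff X {} g (Throw Xpar Xchild); value_returns aff Xpar g v g';
    eval_star Xchild g' g''; hoist_returns aff X g'' g'''\<rbrakk>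
   \<Longrightarrow> hoist_returns aff X g g'''"
| "\<lbrakk>hoist_returns aff X g g'; eval_star X g' g''; g'' X = Some d; may_draw d v\<rbrakk>
   \<Longrightarrow> value_returns aff X g v (intervene X v g'')"

definition observe_returns ::
  "'x analysis \<Rightarrow> 'x \<Rightarrow> val \<Rightarrow> 'x state \<Rightarrow> 'x state \<Rightarrow> real \<Rightarrow> bool" where
  "observe_returns aff X v g g' s \<longleftrightarrow>
     (\<exists>g1 g2 d. hoist_returns aff X g g1 \<and> eval_star X g1 g2 \<and> g2 X = Some d \<and>
                dist_density d v = Some s \<and> g' = intervene X v g2)"

text \<open>
  \<open>hoist_values aff X g Y\<close>: hoisting \<open>X\<close> in \<open>g\<close> passes \<open>Y\<close> to VALUE, at any depth of the
  recursion and whether or not the hoist itself ever returns.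
\<close>

inductive hoist_values :: "'x analysis \<Rightarrow> 'x \<Rightarrow> 'x state \<Rightarrow> 'x \<Rightarrow> bool" for aff where
  "hoist_helper aff X {} g (Throw Xpar Xchild) \<Longrightarrow> hoist_values aff X g Xpar"
| "\<lbrakk>hoist_helper aff X {} g (Throw Xpar Xchild); hoist_values aff Xpar g Y\<rbrakk>
   \<Longrightarrow> hoist_values aff X g Y"
| "\<lbrakk>hoist_helper aff X {} g (Throw Xpar Xchild); value_returns aff Xpar g v g';
    eval_star Xchild g' g''; hoist_values aff X g'' Y\<rbrakk>
   \<Longrightarrow> hoist_values aff X g Y"


section \<open>Executions\<close>

text \<open>In \<open>Assume d X\<close>, \<open>X\<close> is the variable the call returns.\<close>

datatype 'x call = Assume "'x dist" 'x | Value 'x | Observe 'x val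

text \<open>A program knows only variables that earlier calls returned, hence \<open>fvd d \<subseteq> dom g\<close>.\<close>

fun call_returns :: "'x analysis \<Rightarrow> 'x state \<Rightarrow> 'x call \<Rightarrow> 'x state \<Rightarrow> bool" where
  "call_returns aff g (Assume d X) g' \<longleftrightarrow> X \<notin> dom g \<and> fvd d \<subseteq> dom g \<and> g' = g(X \<mapsto> d)"
| "call_returns aff g (Value X) g' \<longleftrightarrow> (\<exists>v. value_returns aff X g v g')"
| "call_returns aff g (Observe X v) g' \<longleftrightarrow> (\<exists>s. observe_returns aff X v g g' s)"

fun passes_to_value :: "'x analysis \<Rightarrow> 'x state \<Rightarrow> 'x call \<Rightarrow> 'x \<Rightarrow> bool" where
  "passes_to_value aff g (Assume d X) Y \<longleftrightarrow> False"
| "passes_to_value aff g (Value X) Y \<longleftrightarrow> Y = X \<or> hoist_values aff X g Y"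
| "passes_to_value aff g (Observe X v) Y \<longleftrightarrow> hoist_values aff X g Y"

text \<open>
  Call \<open>cs ! i\<close> is made in state \<open>gs ! i\<close> and returns \<open>gs ! Suc i\<close>.  The last call may not
  have returned: then \<open>length gs = length cs\<close>.
\<close>

definition execution :: "'x analysis \<Rightarrow> 'x state list \<Rightarrow> 'x call list \<Rightarrow> bool" where
  "execution aff gs cs \<longleftrightarrow>
     gs \<noteq> [] \<and> gs ! 0 = Map.empty \<and>
     (length gs = length cs \<or> length gs = Suc (length cs)) \<and>
     (\<forall>i. Suc i < length gs \<longrightarrow> call_returns aff (gs ! i) (cs ! i) (gs ! Suc i))"

definition exec_vars :: "'x call list \<Rightarrow> 'x set" where
  "exec_vars cs = {X. \<exists>d. Assume d X \<in> set cs}"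

end

theory Submission
  imports Defs
begin

text \<open>
  A hoist in a state of \<open>C\<close> never throws: every swap it attempts is along a parent edge that is
  still present, it is legal by the assertion, and so it succeeds and stays in \<open>C\<close>.  Hence the
  state between calls stays in \<open>C\<close>, with every variable of \<open>Xs\<close> bound to a value.  The only
  state that may lie outside \<open>C\<close> is the one between the assumption of an \<open>X \<in> Xs\<close> and its
  sampling; but there \<open>X\<close> depends on values only, so it is already a root, and sampling it is the
  same as intervening on \<open>X\<close> in the preceding state.
\<close>

section \<open>Swapping\<close>

lemma fv_subst_Const: "fv (subst X (Const c) e) = fv e - {X}"
  by (induction e) auto

lemma parents_cong: "g' X = g X \<Longrightarrow> valued g' = valued g \<Longrightarrow> parents g' X = parents g X"
  by (simp add: parents_def split: option.split)

lemma parent_rel_iff: "(Y, X) \<in> parent_rel g \<longleftrightarrow> Y \<in> parents g X"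
  by (simp add: parent_rel_def)

lemma parents_imp_dom: "Y \<in> parents g X \<Longrightarrow> X \<in> dom g"
  by (auto simp: parents_def split: option.splits)

lemma acyclic_not_self_parent:
  assumes "acyclic (parent_rel g)"
  shows "X \<notin> parents g X"
proof
  assume "X \<in> parents g X"
  then have "(X, X) \<in> (parent_rel g)\<^sup>+" by (intro r_into_trancl) (simp add: parent_rel_iff)
  then show False using assms by (simp add: acyclic_def)
qed

lemma acyclic_not_mutual_parents:
  assumes "acyclic (parent_rel g)" "X \<in> parents g Y"
  shows "Y \<notin> parents g X"
proof
  assume "Y \<in> parents g X"
  then have "(X, X) \<in> (parent_rel g)\<^sup>+"
    using assms(2) by (intro trancl_into_trancl[OF r_into_trancl, of X Y]) (simp_all add: parent_rel_iff)
  then show False using assms(1) by (simp add: acyclic_def)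
qed

text \<open>All failing combinations of distributions are discarded once here, so that later
  arguments see only the three successful shapes.\<close>

lemma swap_True_cases:
  assumes "swap aff X1 X2 g = (g', True)"
  obtains (gaussian) \<mu>0 v0 \<mu> v a b where "g X1 = Some (Gaussian \<mu>0 v0)" "g X2 = Some (Gaussian \<mu> v)"
      "aff X1 \<mu> = Some (a, b)" "deps g v0 = {}" "deps g v = {}"
      "g' = swap_gaussian X1 X2 \<mu>0 v0 a b v g"
    | (beta) a b where "g X1 = Some (BetaD a b)" "g X2 = Some (Bern (Var X1))"
      "g' = swap_beta_bern X1 X2 a b g"
    | (bern) p1 p2 where "g X1 = Some (Bern p1)" "g X2 = Some (Bern p2)"
      "g' = swap_bern X1 X2 p1 p2 g"
proof -
  obtain d1 where d1: "g X1 = Some d1"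
    using assms by (cases "g X1") (simp_all add: swap_def)
  obtain d2 where d2: "g X2 = Some d2"
    using assms d1 by (cases "g X2"; cases d1) (simp_all add: swap_def)
  note sw = assms[unfolded swap_def d1 d2]
  show ?thesis
  proof (cases d1)
    case d1': (Gaussian \<mu>0 v0)
    show ?thesis
    proof (cases d2)
      case d2': (Gaussian \<mu> v)
      obtain a b where ab: "aff X1 \<mu> = Some (a, b)"
        using sw d1' d2' by (cases "aff X1 \<mu>") auto
      then show ?thesis
        using sw d1 d2 d1' d2' by (intro gaussian[of \<mu>0 v0 \<mu> v a b]) (simp_all split: if_splits)
    qed (use sw d1' in simp_all)
  next
    case d1': (BetaD a b)
    show ?thesis
    proof (cases d2)
      case d2': (Bern p)
      have "p = Var X1" "g' = swap_beta_bern X1 X2 a b g"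
        using sw d1' d2' by (simp_all split: if_splits)
      then show ?thesis using d1 d2 d1' d2' by (intro beta) simp_all
    qed (use sw d1' in simp_all)
  next
    case d1': (Bern p1)
    show ?thesis
    proof (cases d2)
      case d2': (Bern p2)
      have "g' = swap_bern X1 X2 p1 p2 g" using sw d1' d2' by simp
      then show ?thesis using d1 d2 d1' d2' by (intro bern) simp_all
    qed (use sw d1' in simp_all)
  qed (use sw in simp)
qed

text \<open>\<open>valued\<close> survives because both swapped variables carry a Gaussian, Beta or
  Bernoulli distribution before and after, never a Dirac one.\<close>

lemma swap_frame:
  assumes "swap aff X1 X2 g = (g', True)"
  shows "dom g' = dom g" "valued g' = valued g" "Z \<noteq> X1 \<Longrightarrow> Z \<noteq> X2 \<Longrightarrow> g' Z = g Z"
proof -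
  have *: "dom g' = dom g \<and> valued g' = valued g \<and> (Z \<noteq> X1 \<longrightarrow> Z \<noteq> X2 \<longrightarrow> g' Z = g Z)"
    using assms
    by (cases rule: swap_True_cases)
      (auto simp: swap_gaussian_def swap_beta_bern_def swap_bern_def Let_def valued_def
        fun_eq_iff split: if_splits)
  show "dom g' = dom g" "valued g' = valued g" "Z \<noteq> X1 \<Longrightarrow> Z \<noteq> X2 \<Longrightarrow> g' Z = g Z"
    using * by auto
qed

lemma affine_analysis_fv:
  assumes "affine_analysis aff" "aff X e = Some (a, b)"
  shows "fv a \<union> fv b = fv e - {X}"
proof -
  have "\<forall>X e a b. aff X e = Some (a, b) \<longrightarrow> fv a \<union> fv b = fv e - {X}"
    using assms(1) unfolding affine_analysis_def by simp
  with assms(2) show ?thesis by blast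
qed

text \<open>\<open>can_swap\<close> tests a predicted graph. The prediction is exact, so the
  acyclicity it tests passes to the state the swap returns. Acyclicity of \<open>g\<close> rules out
  self-parents and mutual parents, which is why deleting \<open>X1\<close> and \<open>X2\<close>
  from the common parents loses nothing else.\<close>

lemma swap_parents_eq:
  assumes aff: "affine_analysis aff" and acyc: "acyclic (parent_rel g)"
    and par: "X1 \<in> parents g X2" and sw: "swap aff X1 X2 g = (g', True)"
  shows "parents g' Z = swapped_parents X1 X2 g Z"
proof (cases "Z = X1 \<or> Z = X2")
  case False
  then have "g' Z = g Z" by (intro swap_frame(3)[OF sw]) simp_all
  then have "parents g' Z = parents g Z" by (rule parents_cong) (rule swap_frame(2)[OF sw])
  then show ?thesis using False by (simp add: swapped_parents_def)
next
  case True
  have ne: "X1 \<noteq> X2" using acyclic_not_self_parent[OF acyc] par by auto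
  have no: "X1 \<notin> parents g X1" "X2 \<notin> parents g X2" "X2 \<notin> parents g X1"
    using acyclic_not_self_parent[OF acyc] acyclic_not_mutual_parents[OF acyc par] by blast+
  have val: "valued g' = valued g" using swap_frame(2)[OF sw] .
  \<comment> \<open>Reduces all three kinds of swap to the same two equations. In each case
    \<open>p\<close> computes the parents before the swap and \<open>p'\<close> those after
    it.\<close>
  have goal: ?thesis
    if "parents g' X1 = insert X2 ((parents g X1 \<union> parents g X2) - {X1, X2})"
      "parents g' X2 = (parents g X1 \<union> parents g X2) - {X1, X2}"
    using True
  proof
    assume "Z = X1"
    then show ?thesis using that(1) by (simp add: swapped_parents_def)
  next
    assume "Z = X2"
    then show ?thesis using that(2) ne by (simp add: swapped_parents_def)
  qed
  show ?thesis
    using sw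
  proof (cases rule: swap_True_cases)
    case (gaussian \<mu>0 v0 \<mu> v a b)
    have nv: "\<not> valued g X1" "\<not> valued g X2" using gaussian(1,2) by (simp_all add: valued_def)
    have "fv a \<union> fv b = fv \<mu> - {X1}"
      by (rule affine_analysis_fv[OF aff gaussian(3)])
    then have ab: "Y \<in> fv a \<or> Y \<in> fv b \<longleftrightarrow> Y \<in> fv \<mu> \<and> Y \<noteq> X1" for Y by blast
    \<comment> \<open>Both variances mention values only, so they contribute no parents although
      they are copied into the new distributions.\<close>
    have v: "\<And>Y. Y \<in> fv v0 \<Longrightarrow> valued g Y" "\<And>Y. Y \<in> fv v \<Longrightarrow> valued g Y"
      using gaussian(4,5) by (auto simp: deps_def)
    have p: "Y \<in> parents g X1 \<longleftrightarrow> Y \<in> fv \<mu>0 \<and> \<not> valued g Y"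
      "Y \<in> parents g X2 \<longleftrightarrow> Y \<in> fv \<mu> \<and> \<not> valued g Y" for Y
      using gaussian(1,2) v by (auto simp: parents_def)
    have p': "Y \<in> parents g' X1 \<longleftrightarrow>
        (Y = X2 \<or> Y \<in> fv a \<or> Y \<in> fv b \<or> Y \<in> fv \<mu>0) \<and> \<not> valued g Y"
      "Y \<in> parents g' X2 \<longleftrightarrow> (Y \<in> fv a \<or> Y \<in> fv b \<or> Y \<in> fv \<mu>0) \<and> \<not> valued g Y" for Y
      using ne v unfolding parents_def val
      by (auto simp: gaussian(6) swap_gaussian_def Let_def)
    \<comment> \<open>The analysis determines only the union of \<open>fv a\<close> and
      \<open>fv b\<close>. Both new distributions contain \<open>a\<close> and \<open>b\<close>
      together, so the union suffices.\<close>
    have p'': "Y \<in> parents g' X1 \<longleftrightarrow>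
        (Y = X2 \<or> Y \<in> fv \<mu> \<and> Y \<noteq> X1 \<or> Y \<in> fv \<mu>0) \<and> \<not> valued g Y"
      "Y \<in> parents g' X2 \<longleftrightarrow> (Y \<in> fv \<mu> \<and> Y \<noteq> X1 \<or> Y \<in> fv \<mu>0) \<and> \<not> valued g Y" for Y
      using ab[of Y] unfolding p' by argo+
    note no' = no[unfolded p, simplified nv]
    show ?thesis by (rule goal; rule set_eqI) (use no' ne nv in \<open>auto simp: p p''\<close>)
  next
    case (beta a b)
    have nv: "\<not> valued g X1" "\<not> valued g X2" using beta(1,2) by (simp_all add: valued_def)
    have p: "Y \<in> parents g X1 \<longleftrightarrow> (Y \<in> fv a \<or> Y \<in> fv b) \<and> \<not> valued g Y"
      "Y \<in> parents g X2 \<longleftrightarrow> Y = X1" for Y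
      using beta(1,2) nv by (auto simp: parents_def)
    have p': "Y \<in> parents g' X1 \<longleftrightarrow> (Y = X2 \<or> Y \<in> fv a \<or> Y \<in> fv b) \<and> \<not> valued g Y"
      "Y \<in> parents g' X2 \<longleftrightarrow> (Y \<in> fv a \<or> Y \<in> fv b) \<and> \<not> valued g Y" for Y
      using ne unfolding parents_def val by (auto simp: beta(3) swap_beta_bern_def)
    note no' = no[unfolded p, simplified nv]
    show ?thesis by (rule goal; rule set_eqI) (use no' ne nv in \<open>auto simp: p p'\<close>)
  next
    case (bern p1 p2)
    have nv: "\<not> valued g X1" "\<not> valued g X2" using bern(1,2) by (simp_all add: valued_def)
    have p: "Y \<in> parents g X1 \<longleftrightarrow> Y \<in> fv p1 \<and> \<not> valued g Y"
      "Y \<in> parents g X2 \<longleftrightarrow> Y \<in> fv p2 \<and> \<not> valued g Y" for Y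
      using bern(1,2) by (auto simp: parents_def)
    \<comment> \<open>Substituting the constants 0 and 1 for \<open>X1\<close> removes exactly
      \<open>X1\<close> from the variables of \<open>p2\<close>.\<close>
    have p': "Y \<in> parents g' X1 \<longleftrightarrow>
        (Y = X2 \<or> Y \<in> fv p1 \<or> Y \<in> fv p2 \<and> Y \<noteq> X1) \<and> \<not> valued g Y"
      "Y \<in> parents g' X2 \<longleftrightarrow> (Y \<in> fv p1 \<or> Y \<in> fv p2 \<and> Y \<noteq> X1) \<and> \<not> valued g Y" for Y
      using ne unfolding parents_def val
      by (auto simp: bern(3) swap_bern_def Let_def fv_subst_Const)
    note no' = no[unfolded p, simplified nv]
    show ?thesis by (rule goal; rule set_eqI) (use no' ne nv in \<open>auto simp: p p'\<close>)
  qed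
qed


section \<open>Hoisting in a closed family\<close>

text \<open>One parent step suffices to express closure under ancestors, which avoids carrying a
  transitive closure through swaps.\<close>

definition anc_closed :: "'x state \<Rightarrow> 'x set \<Rightarrow> bool" where
  "anc_closed g A \<longleftrightarrow> (\<forall>X\<in>A. parents g X \<subseteq> A)"

text \<open>
  The frame condition quantifies over all ancestor-closed \<open>A\<close>, rather than naming the set of
  ancestors of \<open>M\<close>, because hoisting changes that set; in this form frames compose.
\<close>

definition hoist_frame :: "'x state \<Rightarrow> 'x state \<Rightarrow> 'x set \<Rightarrow> 'x set \<Rightarrow> bool" where
  "hoist_frame g g' R M \<longleftrightarrow> dom g' = dom g \<and> valued g' = valued g \<and> (\<forall>Y\<in>R. g' Y = g Y) \<and>
     (\<forall>A. anc_closed g A \<and> M \<subseteq> A \<longrightarrow> anc_closed g' A \<and> (\<forall>Y. Y \<notin> A \<longrightarrow> g' Y = g Y))"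

section \<open>Composing frame conditions\<close>

lemma hoist_frame_refl: "hoist_frame g g R M"
  by (simp add: hoist_frame_def)

text \<open>The first frame keeps \<open>A\<close> ancestor-closed, which is what the second frame
  asks of \<open>A\<close>. The protected set may shrink and the set of hoisted variables may
  grow.\<close>

lemma hoist_frame_trans:
  assumes 1: "hoist_frame g g' R M" and 2: "hoist_frame g' g'' R' M'"
    and sub: "R \<subseteq> R'" "M \<subseteq> N" "M' \<subseteq> N"
  shows "hoist_frame g g'' R N"
proof -
  have "dom g'' = dom g" "valued g'' = valued g"
    using 1 2 unfolding hoist_frame_def by simp_all
  moreover have "g'' Y = g Y" if "Y \<in> R" for Y
  proof -
    have "g'' Y = g' Y" using that 2 sub(1) unfolding hoist_frame_def by blast
    also have "g' Y = g Y" using that 1 unfolding hoist_frame_def by blast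
    finally show ?thesis .
  qed
  moreover have "anc_closed g'' A \<and> (\<forall>Y. Y \<notin> A \<longrightarrow> g'' Y = g Y)"
    if A: "anc_closed g A" "N \<subseteq> A" for A
  proof -
    have "anc_closed g' A \<and> (\<forall>Y. Y \<notin> A \<longrightarrow> g' Y = g Y)"
      using 1 A sub(2) unfolding hoist_frame_def by (meson subset_trans)
    moreover from this have "anc_closed g'' A \<and> (\<forall>Y. Y \<notin> A \<longrightarrow> g'' Y = g' Y)"
      using 2 A(2) sub(3) unfolding hoist_frame_def by (meson subset_trans)
    ultimately show ?thesis by simp
  qed
  ultimately show ?thesis unfolding hoist_frame_def by blast
qed

lemma hoist_frame_parents: "hoist_frame g g' R M \<Longrightarrow> Y \<in> R \<Longrightarrow> parents g' Y = parents g Y"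
  by (rule parents_cong) (simp_all add: hoist_frame_def)

lemma hoist_frame_anc_closed: "hoist_frame g g' R M \<Longrightarrow> anc_closed g R \<Longrightarrow> anc_closed g' R"
  by (simp add: anc_closed_def hoist_frame_parents)

text \<open>Hoisting a parent must not disturb the child waiting for it. The frame is applied to
  \<open>Y\<close> together with its ancestors; a child of \<open>Y\<close> in that set would close
  a cycle.\<close>

lemma hoist_frame_child:
  assumes frame: "hoist_frame g g' R {Y}" and acyc: "acyclic (parent_rel g)" and Y: "Y \<in> parents g X"
  shows "g' X = g X"
proof -
  let ?A = "{Z. (Z, Y) \<in> (parent_rel g)\<^sup>*}"
  have "parents g Z \<subseteq> ?A" if "Z \<in> ?A" for Z
  proof
    fix W assume "W \<in> parents g Z"
    then have "(W, Z) \<in> parent_rel g" by (simp add: parent_rel_iff)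
    then show "W \<in> ?A" using that by (simp add: converse_rtrancl_into_rtrancl)
  qed
  then have "anc_closed g ?A" unfolding anc_closed_def by (rule ballI)
  moreover have "X \<notin> ?A"
  proof
    assume "X \<in> ?A"
    then have "(X, Y) \<in> (parent_rel g)\<^sup>*" by simp
    moreover have "(Y, X) \<in> parent_rel g" using Y by (simp add: parent_rel_iff)
    ultimately have "(X, X) \<in> (parent_rel g)\<^sup>+" by (rule rtrancl_into_trancl1)
    then show False using acyc by (simp add: acyclic_def)
  qed
  moreover have "{Y} \<subseteq> ?A" by simp
  ultimately show ?thesis using frame unfolding hoist_frame_def by meson
qed

text \<open>Relative to the roots \<open>R\<close>, each variable depends only on \<open>R\<close>
  and earlier list members. Hoisting the parents in order builds such a chain, and swapping in
  reverse order consumes it from its end.\<close>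

fun root_chain :: "'x state \<Rightarrow> 'x set \<Rightarrow> 'x list \<Rightarrow> bool" where
  "root_chain g R [] \<longleftrightarrow> True"
| "root_chain g R (X # P) \<longleftrightarrow> parents g X \<subseteq> R \<and> root_chain g (insert X R) P"

lemma root_chain_append:
  "root_chain g R (P @ Q) \<longleftrightarrow> root_chain g R P \<and> root_chain g (R \<union> set P) Q"
  by (induction P arbitrary: R) auto

lemma root_chain_cong:
  "(\<And>X. X \<in> set P \<Longrightarrow> parents g X = parents g' X) \<Longrightarrow> root_chain g R P = root_chain g' R P"
  by (induction P arbitrary: R) auto

text \<open>Carried beside membership in \<open>C\<close>, which implies neither property. Parents
  in the domain supply the premise \<open>X1 \<in> dom g\<close> of
  \<open>closed_family\<close>.\<close>

definition wf_state :: "'x state \<Rightarrow> bool" where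
  "wf_state g \<longleftrightarrow> acyclic (parent_rel g) \<and> (\<forall>X. parents g X \<subseteq> dom g)"

section \<open>Swaps and hoists inside a closed family\<close>

locale closed_analysis =
  fixes aff :: "'x analysis" and C :: "'x state set"
  assumes aff: "affine_analysis aff" and closed: "closed_family aff C"
begin

definition good :: "'x state \<Rightarrow> bool" where
  "good g \<longleftrightarrow> g \<in> C \<and> wf_state g"

text \<open>The closed family makes the swap succeed; since the predicted graph is the actual one,
  \<open>can_swap\<close> makes the result acyclic.\<close>

lemma good_swap:
  assumes g: "good g" and par: "X1 \<in> parents g X2" and can: "can_swap X1 X2 g"
  shows "\<exists>g'. swap aff X1 X2 g = (g', True) \<and> good g' \<and>
    (\<forall>Z. parents g' Z = swapped_parents X1 X2 g Z) \<and>
    (\<forall>R. X1 \<notin> R \<longrightarrow> X2 \<notin> R \<longrightarrow> hoist_frame g g' R {X2})"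
proof -
  have acyc: "acyclic (parent_rel g)" and dom: "\<And>X. parents g X \<subseteq> dom g" and "g \<in> C"
    using g by (auto simp: good_def wf_state_def)
  have d: "X1 \<in> dom g" "X2 \<in> dom g" using dom par parents_imp_dom by fast+
  obtain g' where g': "swap aff X1 X2 g = (g', True)" "g' \<in> C"
    using closed \<open>g \<in> C\<close> par can d unfolding closed_family_def by blast
  have pars: "\<And>Z. parents g' Z = swapped_parents X1 X2 g Z"
    by (rule swap_parents_eq[OF aff acyc par g'(1)])
  note frame = swap_frame[OF g'(1)]
  have "acyclic (parent_rel g')"
    using can by (simp add: can_swap_def parent_rel_def pars)
  moreover have "parents g' Z \<subseteq> dom g'" for Z
    using dom d unfolding pars frame(1) by (auto simp: swapped_parents_def Let_def)
  moreover have "hoist_frame g g' R {X2}" if "X1 \<notin> R" "X2 \<notin> R" for R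
  proof -
    have "anc_closed g' A \<and> (\<forall>Y. Y \<notin> A \<longrightarrow> g' Y = g Y)" if A: "anc_closed g A" "X2 \<in> A" for A
    proof -
      \<comment> \<open>As \<open>X1\<close> is a parent of \<open>X2\<close>, the set
        \<open>A\<close> contains both and all their parents, and the swap only rearranges edges
        among these.\<close>
      have sub: "parents g X1 \<subseteq> A" "parents g X2 \<subseteq> A" and "X1 \<in> A"
        using A par unfolding anc_closed_def by blast+
      have "parents g' Z \<subseteq> A" if "Z \<in> A" for Z
        using that sub A unfolding pars swapped_parents_def Let_def anc_closed_def by auto
      moreover have "g' Y = g Y" if "Y \<notin> A" for Y
        using that \<open>X1 \<in> A\<close> A(2) by (intro frame(3)) auto
      ultimately show ?thesis by (simp add: anc_closed_def)
    qed
    moreover have "\<forall>Y\<in>R. g' Y = g Y" using that by (auto intro!: frame(3))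
    ultimately show ?thesis using frame(1,2) unfolding hoist_frame_def by blast
  qed
  ultimately have "good g'" "\<And>R. X1 \<notin> R \<Longrightarrow> X2 \<notin> R \<Longrightarrow> hoist_frame g g' R {X2}"
    using g'(2) by (simp_all add: good_def wf_state_def)
  then show ?thesis using g'(1) pars by simp
qed

text \<open>Each variable of \<open>P\<close> stays a parent of \<open>X\<close> until its turn, so
  every swap runs along an existing edge and cannot fail once it passes the legality
  assertion.\<close>

lemma swap_parents_good:
  assumes "good g" "X \<notin> R" "distinct P" "root_chain g R P"
    "set P \<subseteq> parents g X" "parents g X \<subseteq> R \<union> set P"
  shows "swap_parents aff X R (rev P) g = Assertion_failed \<or>
    (\<exists>g'. swap_parents aff X R (rev P) g = Return g' \<and> good g' \<and>
          parents g' X \<subseteq> R \<and> hoist_frame g g' R {X})"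
  using assms
\<comment> \<open>The loop runs over \<open>rev P\<close>, so the last element of \<open>P\<close>
  is swapped first.\<close>
proof (induction P arbitrary: g rule: rev_induct)
  case Nil
  then show ?case by (simp add: hoist_frame_refl)
next
  case (snoc Y P)
  show ?case
  proof (cases "Y \<in> R")
    case True
    moreover have "distinct P" "root_chain g R P" "set P \<subseteq> parents g X" "parents g X \<subseteq> R \<union> set P"
      using snoc.prems True by (auto simp: root_chain_append)
    ultimately show ?thesis using snoc.IH[OF snoc.prems(1,2)] by simp
  next
    case Y: False
    show ?thesis
    proof (cases "can_swap Y X g")
      case False
      then show ?thesis using Y by simp
    next
      case can: True
      have par: "Y \<in> parents g X" using snoc.prems by auto
      obtain g' where g': "swap aff Y X g = (g', True)" "good g'"
        "\<forall>Z. parents g' Z = swapped_parents Y X g Z"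
        "\<forall>R. Y \<notin> R \<longrightarrow> X \<notin> R \<longrightarrow> hoist_frame g g' R {X}"
        using good_swap[OF snoc.prems(1) par can] by (elim exE conjE)
      have acyc: "acyclic (parent_rel g)" using snoc.prems(1) by (simp add: good_def wf_state_def)
      have X: "X \<notin> parents g X" using acyclic_not_self_parent[OF acyc] .
      have YX: "Y \<noteq> X" using par X by auto
      have parX: "parents g' X = (parents g Y \<union> parents g X) - {Y, X}"
        using g'(3) YX by (simp add: swapped_parents_def)
      \<comment> \<open>The chain bounds the parents that \<open>X\<close> inherits from
        \<open>Y\<close>: they are roots or variables still to be swapped.\<close>
      have "parents g Y \<subseteq> R \<union> set P" using snoc.prems(4) by (simp add: root_chain_append)
      then have "parents g' X \<subseteq> R \<union> set P" using parX snoc.prems(6) by auto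
      moreover have "set P \<subseteq> parents g' X"
        using parX snoc.prems(3,5) X by auto
      moreover have "root_chain g' R P"
      proof -
        \<comment> \<open>The remaining \<open>Z\<close> differ from \<open>Y\<close> by
          distinctness and from \<open>X\<close> because \<open>X\<close> is not its own parent, so
          the swap leaves their parents alone.\<close>
        have "parents g Z = parents g' Z" if "Z \<in> set P" for Z
          using that snoc.prems(3,5) X spec[OF g'(3), of Z] by (auto simp: swapped_parents_def Let_def)
        then show ?thesis using root_chain_cong[of P g g'] snoc.prems(4)
          by (simp add: root_chain_append)
      qed
      ultimately have "swap_parents aff X R (rev P) g' = Assertion_failed \<or>
         (\<exists>g''. swap_parents aff X R (rev P) g' = Return g'' \<and> good g'' \<and>
          parents g'' X \<subseteq> R \<and> hoist_frame g' g'' R {X})"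
        using snoc.IH[OF g'(2) snoc.prems(2)] snoc.prems(3) by simp
      moreover have "hoist_frame g g'' R {X}" if "hoist_frame g' g'' R {X}" for g''
        by (rule hoist_frame_trans[OF g'(4)[rule_format, OF Y snoc.prems(2)] that]) simp_all
      moreover have "swap_parents aff X R (rev (P @ [Y])) g = swap_parents aff X R (rev P) g'"
        using Y can g'(1) by simp
      ultimately show ?thesis by metis
    qed
  qed
qed

text \<open>Mutual induction over the two relations. In the loop, \<open>R\<close> is the set of
  roots at entry and \<open>R'\<close> the current one;
  \<open>set P \<inter> R' \<subseteq> R\<close> makes the test against \<open>R\<close> decide
  membership in \<open>R'\<close> for the variables still to come. The last conjunct keeps the
  distribution of the variable being hoisted while its parents are processed.\<close>

lemma hoist_good:
  "hoist_helper aff X R g r \<Longrightarrow> good g \<Longrightarrow> anc_closed g R \<Longrightarrow> X \<notin> R \<Longrightarrow>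
     r = Assertion_failed \<or>
     (\<exists>g'. r = Return g' \<and> good g' \<and> parents g' X \<subseteq> R \<and> hoist_frame g g' R {X})"
  "hoist_parents aff R P R' g r \<Longrightarrow> good g \<Longrightarrow> anc_closed g R' \<Longrightarrow> R \<subseteq> R' \<Longrightarrow>
     set P \<inter> R' \<subseteq> R \<Longrightarrow> distinct P \<Longrightarrow>
     r = Assertion_failed \<or>
     (\<exists>g'. r = Return g' \<and> good g' \<and> root_chain g' R' P \<and> hoist_frame g g' R' (set P) \<and>
        (\<forall>X. set P \<subseteq> parents g X \<longrightarrow> g' X = g X))"
proof (induction rule: hoist_helper_hoist_parents.inducts)
  case (1 P g X R g')
  have "distinct P" using 1 by (auto simp: topo_sorted_def)
  then have IH: "good g'" "root_chain g' R P" "hoist_frame g g' R (set P)" "g' X = g X"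
    using 1 by auto
  \<comment> \<open>\<open>X\<close> is a common child of all of \<open>P\<close>, so the loop left
    its distribution unchanged.\<close>
  have pars: "parents g' X = set P"
    using IH(3,4) 1(1) parents_cong[of g' X g] by (simp add: hoist_frame_def)
  have frame: "hoist_frame g g' R {X}"
  proof -
    \<comment> \<open>An ancestor-closed set containing \<open>X\<close> contains its parents, so
      the frame for \<open>set P\<close> is also one for \<open>{X}\<close>.\<close>
    have "set P \<subseteq> A" if "anc_closed g A" "{X} \<subseteq> A" for A
      using that 1(1) by (simp add: anc_closed_def)
    then show ?thesis using IH(3) unfolding hoist_frame_def by meson
  qed
  have pars': "set P \<subseteq> parents g' X" "parents g' X \<subseteq> R \<union> set P" using pars by auto
  have "X \<notin> R" using 1 by simp
  from swap_parents_good[OF IH(1) this \<open>distinct P\<close> IH(2) pars'] show ?case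
  proof (elim disjE exE conjE)
    fix g'' assume g'': "swap_parents aff X R (rev P) g' = Return g''" "good g''"
      "parents g'' X \<subseteq> R" "hoist_frame g' g'' R {X}"
    have "hoist_frame g g'' R {X}"
      using hoist_frame_trans[OF frame g''(4)] by simp
    then show ?thesis using g'' by simp
  qed simp
next
  case (2 P g X R r)
  then show ?case by (auto simp: topo_sorted_def)
next
  case (3 R R' g)
  then show ?case by (simp add: hoist_frame_refl)
next
  case (4 X R P R' g r)
  have *: "r = Assertion_failed \<or>
     (\<exists>g'. r = Return g' \<and> good g' \<and> root_chain g' R' P \<and> hoist_frame g g' R' (set P) \<and>
        (\<forall>X. set P \<subseteq> parents g X \<longrightarrow> g' X = g X))"
    using 4 by auto
  have X: "X \<in> R'" using 4 by auto
  \<comment> \<open>A variable that is already a root extends the chain without enlarging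
    \<open>R'\<close>.\<close>
  then have "parents g X \<subseteq> R'" using 4 by (auto simp: anc_closed_def)
  show ?case
    using *
  proof (elim disjE exE conjE)
    fix g' assume g': "r = Return g'" "good g'" "root_chain g' R' P" "hoist_frame g g' R' (set P)"
      "\<forall>X. set P \<subseteq> parents g X \<longrightarrow> g' X = g X"
    have "hoist_frame g g' R' (set (X # P))"
      by (rule hoist_frame_trans[OF hoist_frame_refl g'(4)]) auto
    moreover have "root_chain g' R' (X # P)"
      using g'(3) hoist_frame_parents[OF g'(4) X] \<open>parents g X \<subseteq> R'\<close> X
      by (simp add: insert_absorb)
    ultimately show ?thesis using g' by simp
  qed simp
next
  case (5 X R R' g g1 P r)
  have X: "X \<notin> R'" using 5 by auto
  then have g1: "good g1" "parents g1 X \<subseteq> R'" "hoist_frame g g1 R' {X}"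
    using 5 by auto
  \<comment> \<open>The hoisted \<open>X\<close> now has all its parents in \<open>R'\<close>, so it
    may join the roots.\<close>
  have cl: "anc_closed g1 (insert X R')"
    using hoist_frame_anc_closed[OF g1(3)] g1(2) 5 by (auto simp: anc_closed_def)
  have "r = Assertion_failed \<or>
     (\<exists>g'. r = Return g' \<and> good g' \<and> root_chain g' (insert X R') P \<and>
        hoist_frame g1 g' (insert X R') (set P) \<and> (\<forall>X. set P \<subseteq> parents g1 X \<longrightarrow> g' X = g1 X))"
    using 5 g1(1) cl by auto
  then show ?case
  proof (elim disjE exE conjE)
    fix g'
    assume g': "r = Return g'" "good g'" "root_chain g' (insert X R') P"
      "hoist_frame g1 g' (insert X R') (set P)" "\<forall>X. set P \<subseteq> parents g1 X \<longrightarrow> g' X = g1 X"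
    have "parents g' X \<subseteq> R'" using hoist_frame_parents[OF g'(4)] g1(2) by simp
    moreover have "hoist_frame g g' R' (set (X # P))"
      by (rule hoist_frame_trans[OF g1(3) g'(4)]) auto
    moreover have "g' Z = g Z" if Z: "set (X # P) \<subseteq> parents g Z" for Z
    proof -
      have "g1 Z = g Z"
        using hoist_frame_child[OF g1(3)] 5 Z by (auto simp: good_def wf_state_def)
      moreover from this have "parents g1 Z = parents g Z"
        using g1(3) parents_cong[of g1 Z g] by (simp add: hoist_frame_def)
      ultimately show ?thesis using g'(5) Z by auto
    qed
    ultimately show ?thesis using g' by auto
  qed auto
next
  case (6 X R R' g r P)
  then show ?case by auto
qed

lemma not_throws:
  assumes "good g"
  shows "\<not> hoist_helper aff X {} g (Throw Y Z)"
proof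
  assume "hoist_helper aff X {} g (Throw Y Z)"
  from hoist_good(1)[OF this assms] show False by (simp add: anc_closed_def)
qed

text \<open>Every rule for \<open>hoist_values\<close> starts from a thrown exception.\<close>

lemma not_hoist_values:
  assumes "good g"
  shows "\<not> hoist_values aff X g Y"
proof
  assume "hoist_values aff X g Y"
  then show False by cases (simp_all add: not_throws[OF assms])
qed

lemma hoist_returns_good:
  assumes "hoist_returns aff X g g'" "good g"
  shows "good g' \<and> parents g' X = {} \<and> dom g' = dom g \<and> valued g' = valued g"
  using assms(1)
proof cases
  case 1
  from hoist_good(1)[OF 1 assms(2)] show ?thesis
    by (simp add: anc_closed_def hoist_frame_def)
qed (simp add: not_throws[OF assms(2)])

end

text \<open>Free of any closed family, so that it also applies to the state between assuming a
  variable and sampling it.\<close>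

lemma hoist_helper_root:
  assumes "hoist_helper aff X R g r" "parents g X = {}"
  shows "r = Return g"
  using assms(1)
proof cases
  case (1 P g')
  then have "P = []" using assms(2) by simp
  with 1(4) have "g' = g" by (auto elim: hoist_parents.cases)
  then show ?thesis using 1(1) \<open>P = []\<close> by simp
next
  case (2 P)
  then have "P = []" using assms(2) by simp
  with 2(3) show ?thesis by (auto elim: hoist_parents.cases)
qed

lemma hoist_returns_root:
  assumes "hoist_returns aff X g g'" "parents g X = {}"
  shows "g' = g"
  using assms(1)
proof cases
  case 1
  from hoist_helper_root[OF this assms(2)] show ?thesis by simp
next
  case (2 Xpar Xchild v g1 g2)
  from hoist_helper_root[OF 2(1) assms(2)] show ?thesis by simp
qed

lemma not_hoist_values_root:
  assumes "parents g X = {}"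
  shows "\<not> hoist_values aff X g Y"
proof
  have no: "\<not> hoist_helper aff X {} g (Throw A B)" for A B
    using hoist_helper_root[of aff X "{}" g "Throw A B"] assms by auto
  assume "hoist_values aff X g Y"
  then show False by cases (simp_all add: no)
qed


section \<open>Executions\<close>

lemma valued_fun_upd: "valued (g(X \<mapsto> d)) Y \<longleftrightarrow> (if Y = X then \<exists>c. d = Dirac (Const c) else valued g Y)"
  by (auto simp: valued_def)

text \<open>A fresh variable has no children, because all parents lie in the old domain; hence no
  cycle passes through it.\<close>

lemma wf_state_assume:
  assumes wf: "wf_state g" and X: "X \<notin> dom g" and d: "fvd d \<subseteq> dom g"
  shows "wf_state (g(X \<mapsto> d))"
proof -
  let ?g = "g(X \<mapsto> d)"
  have old: "parents ?g Z \<subseteq> parents g Z" if "Z \<noteq> X" for Z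
  proof -
    have "X \<notin> parents g Z" using wf X by (auto simp: wf_state_def)
    moreover have "\<not> valued g X" using X by (auto simp: valued_def)
    ultimately show ?thesis
      using that by (auto simp: parents_def valued_fun_upd split: option.splits if_splits)
  qed
  have dom: "parents ?g Z \<subseteq> dom g" for Z
  proof (cases "Z = X")
    case True
    then show ?thesis using d by (auto simp: parents_def)
  next
    case False
    then show ?thesis using old wf unfolding wf_state_def by blast
  qed
  \<comment> \<open>A path that does not end in \<open>X\<close> avoids \<open>X\<close> after its
    start as well, since \<open>X\<close> has no outgoing edge.\<close>
  have path: "(A, B) \<in> (parent_rel g)\<^sup>+" if "(A, B) \<in> (parent_rel ?g)\<^sup>+" "B \<noteq> X" for A B
    using that
  proof (induction rule: trancl_induct)
    case (base B)
    then show ?case using old[of B] by (intro r_into_trancl) (auto simp: parent_rel_iff)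
  next
    case (step B D)
    have "B \<noteq> X" using step(2) dom X by (auto simp: parent_rel_iff)
    moreover have "(B, D) \<in> parent_rel g" using step(2,4) old[of D] by (auto simp: parent_rel_iff)
    ultimately show ?case using step.IH by auto
  qed
  have "(A, A) \<notin> (parent_rel ?g)\<^sup>+" for A
  proof
    assume A: "(A, A) \<in> (parent_rel ?g)\<^sup>+"
    then obtain Z where "(A, Z) \<in> parent_rel ?g" by (auto dest: tranclD)
    then have "A \<noteq> X" using dom X unfolding parent_rel_iff by blast
    then show False using path[OF A] wf by (auto simp: wf_state_def acyclic_def)
  qed
  then show ?thesis using dom by (auto simp: wf_state_def acyclic_def)
qed

text \<open>A value has no parents and does not count as a parent, so intervening only removes
  edges.\<close>

lemma wf_state_intervene:
  assumes wf: "wf_state g" and X: "X \<in> dom g"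
  shows "wf_state (intervene X v g)"
proof -
  have *: "parents (intervene X v g) Z \<subseteq> parents g Z" for Z
    by (auto simp: parents_def intervene_def valued_fun_upd split: option.splits if_splits)
  then have "parent_rel (intervene X v g) \<subseteq> parent_rel g"
    by (auto simp: parent_rel_def)
  then have "acyclic (parent_rel (intervene X v g))"
    using wf by (auto simp: wf_state_def intro: acyclic_subset)
  moreover have "dom (intervene X v g) = dom g" using X by (auto simp: intervene_def)
  ultimately show ?thesis using * wf unfolding wf_state_def by (metis subset_trans)
qed

text \<open>Partial evaluation rewrites only the entry that the intervention overwrites, so VALUE
  and OBSERVE both act as a hoist followed by an intervention.\<close>

lemma intervene_eval_star: "eval_star X g g' \<Longrightarrow> intervene X v g' = intervene X v g"
  by (auto simp: eval_star_def intervene_def)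

lemma value_returnsE:
  assumes "value_returns aff X g v g'"
  obtains g1 where "hoist_returns aff X g g1" "X \<in> dom g1" "g' = intervene X v g1"
  using assms
proof cases
  case (1 g1 g2 d)
  then show ?thesis
    using that[of g1] by (auto simp: intervene_eval_star eval_star_def)
qed

lemma observe_returnsE:
  assumes "observe_returns aff X v g g' s"
  obtains g1 where "hoist_returns aff X g g1" "X \<in> dom g1" "g' = intervene X v g1"
proof -
  obtain g1 g2 where "hoist_returns aff X g g1" "eval_star X g1 g2" "g' = intervene X v g2"
    using assms by (auto simp: observe_returns_def)
  then show ?thesis using that[of g1] by (auto simp: intervene_eval_star eval_star_def)
qed

text \<open>\<open>closed_family\<close> constrains only swaps and finiteness of domains. Starting
  in \<open>C\<close> and staying there when intervening on a root are therefore stated separately.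
  The guard \<open>Suc i < length gs\<close> allows for a last call that never returns.\<close>

theorem theorem5p4:
  fixes aff :: "'x analysis" and C :: "'x state set"
    and gs :: "'x state list" and cs :: "'x call list" and Xe Xs :: "'x set"
  assumes "affine_analysis aff"
    and "closed_family aff C"
    and "Map.empty \<in> C"
    and "\<And>g X v. g \<in> C \<Longrightarrow> parents g X = {} \<Longrightarrow> intervene X v g \<in> C"
    and "execution aff gs cs"
    and "Xe \<subseteq> exec_vars cs"
    and "Xs = exec_vars cs - Xe"
    and "\<And>X. Value X \<in> set cs \<Longrightarrow> X \<in> Xs"
    and "\<And>i d X. i < length cs \<Longrightarrow> cs ! i = Assume d X \<Longrightarrow> X \<in> Xe \<Longrightarrow>
           gs ! i \<in> C \<Longrightarrow> (gs ! i)(X \<mapsto> d) \<in> C"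
    and "\<And>i d X. i < length cs \<Longrightarrow> cs ! i = Assume d X \<Longrightarrow> X \<in> Xs \<Longrightarrow>
           Suc i < length cs \<and> cs ! Suc i = Value X \<and> fvd d \<inter> Xe = {}"
  shows "(\<forall>X\<in>Xs. \<exists>i<length cs. cs ! i = Value X \<and>
            (Suc i < length gs \<longrightarrow> (\<exists>v. value_returns aff X (gs ! i) v (gs ! Suc i))))
       \<and> (\<forall>X\<in>Xe. \<forall>i<length cs. \<not> passes_to_value aff (gs ! i) (cs ! i) X)"
proof -
  interpret closed_analysis aff C using assms(1,2) by unfold_locales
  note interv = assms(4) and val_Xs = assms(8) and assume_Xe = assms(9) and assume_Xs = assms(10)
  have len: "length gs = length cs \<or> length gs = Suc (length cs)" and gs0: "gs ! 0 = Map.empty"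
    and call: "\<And>i. Suc i < length gs \<Longrightarrow> call_returns aff (gs ! i) (cs ! i) (gs ! Suc i)"
    using assms(5) by (auto simp: execution_def)
  define settled where "settled g \<longleftrightarrow> good g \<and> dom g \<subseteq> Xe \<union> Xs \<and> (\<forall>X\<in>Xs \<inter> dom g. valued g X)" for g
  \<comment> \<open>The preceding settled state \<open>g\<close> is recorded because
    \<open>gs ! i\<close> itself may lie outside \<open>C\<close>.\<close>
  define pending where "pending i \<longleftrightarrow> (\<exists>g d X. settled g \<and> X \<in> Xs \<and> X \<notin> dom g \<and> fvd d \<subseteq> dom g \<and>
      fvd d \<inter> Xe = {} \<and> gs ! i = g(X \<mapsto> d) \<and> cs ! i = Value X)" for i
  \<comment> \<open>Variables of \<open>d\<close> avoid \<open>Xe\<close>, so they belong to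
    \<open>Xs\<close> and already have values in the settled state.\<close>
  have pending_root: "parents (g(X \<mapsto> d)) X = {}"
    if "settled g" "X \<notin> dom g" "fvd d \<subseteq> dom g" "fvd d \<inter> Xe = {}" for g X d
  proof -
    have "valued g Y \<and> Y \<noteq> X" if "Y \<in> fvd d" for Y
      using that \<open>settled g\<close> \<open>X \<notin> dom g\<close> \<open>fvd d \<subseteq> dom g\<close> \<open>fvd d \<inter> Xe = {}\<close>
      unfolding settled_def by blast
    then show ?thesis by (auto simp: parents_def valued_fun_upd)
  qed
  have settled_intervene: "settled (intervene X v g')"
    if "settled g" "hoist_returns aff X g g'" "X \<in> dom g'" for g g' X v
  proof -
    have g': "good g'" "parents g' X = {}" "dom g' = dom g" "valued g' = valued g"
      using hoist_returns_good[OF that(2)] that(1) by (auto simp: settled_def)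
    then have "good (intervene X v g')"
      using interv wf_state_intervene[OF _ that(3)] by (simp add: good_def)
    then show ?thesis
      using g'(3,4) that(1,3) by (auto simp: settled_def intervene_def valued_fun_upd)
  qed
  have inv: "i < length gs \<Longrightarrow> settled (gs ! i) \<or> pending i" for i
  proof (induction i)
    case 0
    have "good Map.empty"
      using assms(3) by (auto simp: good_def wf_state_def parents_def parent_rel_def acyclic_def)
    then show ?case by (simp add: settled_def gs0)
  next
    case (Suc i)
    have ret: "call_returns aff (gs ! i) (cs ! i) (gs ! Suc i)" using call Suc.prems .
    have i: "i < length cs" using Suc.prems len by auto
    from Suc consider "settled (gs ! i)" | "pending i" by auto
    then show ?case
    proof cases
      case 1
      show ?thesis
      proof (cases "cs ! i")
        case (Assume d X)
        have r: "X \<notin> dom (gs ! i)" "fvd d \<subseteq> dom (gs ! i)" "gs ! Suc i = (gs ! i)(X \<mapsto> d)"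
          using ret Assume by auto
        have "Assume d X \<in> set cs" using Assume i nth_mem by metis
        then have "X \<in> Xe \<union> Xs" using assms(7) by (auto simp: exec_vars_def)
        then show ?thesis
        proof
          assume X: "X \<in> Xe"
          then have "gs ! Suc i \<in> C"
            using assume_Xe[OF i Assume X] 1 r(3) by (simp add: settled_def good_def)
          moreover have "wf_state (gs ! Suc i)"
            using wf_state_assume[OF _ r(1,2)] 1 r(3) by (simp add: settled_def good_def)
          moreover have "X \<notin> Xs" using X assms(7) by auto
          ultimately have "settled (gs ! Suc i)"
            using 1 r(3) X by (auto simp: settled_def good_def valued_fun_upd)
          then show ?thesis ..
        next
          assume X: "X \<in> Xs"
          then have "pending (Suc i)"
            using assume_Xs[OF i Assume X] 1 r unfolding pending_def by blast
          then show ?thesis ..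
        qed
      next
        case (Value X)
        then obtain v g1 where "hoist_returns aff X (gs ! i) g1" "X \<in> dom g1"
            "gs ! Suc i = intervene X v g1"
          using ret by (auto elim!: value_returnsE)
        then show ?thesis using settled_intervene[OF 1] by simp
      next
        case (Observe X v)
        then obtain g1 where "hoist_returns aff X (gs ! i) g1" "X \<in> dom g1"
            "gs ! Suc i = intervene X v g1"
          using ret by (auto elim!: observe_returnsE)
        then show ?thesis using settled_intervene[OF 1] by simp
      qed
    next
      case 2
      then obtain g d X where p: "settled g" "X \<in> Xs" "X \<notin> dom g" "fvd d \<subseteq> dom g"
        "fvd d \<inter> Xe = {}" "gs ! i = g(X \<mapsto> d)" "cs ! i = Value X"
        unfolding pending_def by blast
      obtain v g1 where "hoist_returns aff X (g(X \<mapsto> d)) g1" "gs ! Suc i = intervene X v g1"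
        using ret p(6,7) by (auto elim!: value_returnsE)
      then have eq: "gs ! Suc i = intervene X v (g(X \<mapsto> d))"
        using hoist_returns_root pending_root p by metis
      also have "\<dots> = intervene X v g" by (simp add: intervene_def)
      finally have eq': "gs ! Suc i = intervene X v g" .
      \<comment> \<open>An unbound variable has no parents by the default in \<open>parents\<close>,
        so \<open>C\<close> admits intervening on it in \<open>g\<close>. Well-formedness is instead
        derived through \<open>g(X \<mapsto> d)\<close>, where \<open>X\<close> is bound.\<close>
      have "parents g X = {}" using p(3) parents_imp_dom by fast
      then have "gs ! Suc i \<in> C" using interv p(1) eq' by (simp add: settled_def good_def)
      moreover have "wf_state (gs ! Suc i)"
        unfolding eq
        by (rule wf_state_intervene[OF wf_state_assume]) (use p in \<open>auto simp: settled_def good_def\<close>)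
      ultimately have "settled (gs ! Suc i)"
        using p(1,2) eq' by (auto simp: settled_def good_def intervene_def valued_fun_upd)
      then show ?thesis ..
    qed
  qed
  \<comment> \<open>The bound \<open>i < length gs\<close> includes a final call that has not
    returned.\<close>
  have no_hoist_values: "\<not> hoist_values aff X (gs ! i) Y"
    if "i < length gs" "cs ! i = Value X \<or> (\<exists>v. cs ! i = Observe X v)" for i X Y
    using inv[OF that(1)]
  proof
    assume "settled (gs ! i)"
    then show ?thesis using not_hoist_values by (simp add: settled_def)
  next
    assume "pending i"
    then obtain g d Z where p: "settled g" "Z \<notin> dom g" "fvd d \<subseteq> dom g" "fvd d \<inter> Xe = {}"
      "gs ! i = g(Z \<mapsto> d)" "cs ! i = Value Z"
      unfolding pending_def by blast
    then have "Z = X" using that(2) by simp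
    then show ?thesis using p(5) not_hoist_values_root[OF pending_root[OF p(1-4)]] by simp
  qed
  have "\<exists>i<length cs. cs ! i = Value X \<and>
      (Suc i < length gs \<longrightarrow> (\<exists>v. value_returns aff X (gs ! i) v (gs ! Suc i)))"
    if X: "X \<in> Xs" for X
  proof -
    obtain i d where "i < length cs" "cs ! i = Assume d X"
      using X assms(7) by (auto simp: exec_vars_def in_set_conv_nth)
    then have "Suc i < length cs" "cs ! Suc i = Value X" using assume_Xs X by auto
    then show ?thesis using call[of "Suc i"] by auto
  qed
  moreover have "\<not> passes_to_value aff (gs ! i) (cs ! i) X"
    if X: "X \<in> Xe" and i: "i < length cs" for X i
  proof (cases "cs ! i")
    case (Value Y)
    \<comment> \<open>Direct calls concern \<open>Xs\<close> only, which is disjoint from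
      \<open>Xe\<close>; calls nested in the hoist do not occur.\<close>
    then have "Y \<in> Xs" using val_Xs i nth_mem by metis
    then show ?thesis using Value X assms(7) no_hoist_values i len by auto
  next
    case (Observe Y v)
    then show ?thesis using no_hoist_values i len by auto
  qed auto
  ultimately show ?thesis by blast
qed

end
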